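(* Consider a commutative diagram of modules over a ring consisting of the rows $$A\stackrel{\alpha}{\to}A'',\qquad B'\stackrel{\beta'}{\to}B\stackrel{\beta}{\to}B'',\qquad 0\to C'\stackrel{\gamma'}{\to}C\stackrel{\gamma}{\to}C''$$ and the columns $$B'\stackrel{g'}{\to}C',\qquad A\stackrel{f}{\to}B\stackrel{g}{\to}C,\qquad 0\to A''\stackrel{f''}{\to}B''\stackrel{g''}{\to}C'',$$ so that $\beta f=f''\alpha$, $g\beta'=\gamma'g'$ and $g''\beta=\gamma g$. Assume that the rows and columns are exact (the rows at $B$, $C'$ and $C$, and the columns at $B$, $A''$ and $B''$). Then the complexes $$0\to\operatorname{Cok}\alpha\to\operatorname{Cok}\beta\to\operatorname{Cok}\gamma\to 0\qquad\text{and}\qquad 0\to\operatorname{Cok}g'\to\operatorname{Cok}g\to\operatorname{Cok}g''\to 0,$$ given by taking the cokernels of the horizontal maps at the right and of the vertical maps at the bottom, respectively, have isomorphic homology in each position.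
   Context: The maps $\operatorname{Cok}\alpha\to\operatorname{Cok}\beta\to\operatorname{Cok}\gamma$ are induced by $f''$ and $g''$, and the maps $\operatorname{Cok}g'\to\operatorname{Cok}g\to\operatorname{Cok}g''$ are induced by $\gamma'$ and $\gamma$. "Isomorphic homology in each position" means: the homology at $\operatorname{Cok}\alpha$ is isomorphic to the homology at $\operatorname{Cok}g'$, the homology at $\operatorname{Cok}\beta$ to that at $\operatorname{Cok}g$, and the homology at $\operatorname{Cok}\gamma$ to that at $\operatorname{Cok}g''$. *)

theory Defs
  imports "HOL-Algebra.Module" "HOL-Algebra.AbelCoset"
begin

text \<open>
  The library locale \<^locale>\<open>module\<close> requires a commutative base ring. The axioms below are the
  same ones over an arbitrary unital ring; right modules are covered by passing to the opposite ring.
\<close>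

locale left_module = R?: ring R + M?: abelian_group M
  for R (structure) and M (structure) +
  assumes smult_closed:
      "\<lbrakk>r \<in> carrier R; x \<in> carrier M\<rbrakk> \<Longrightarrow> r \<odot>\<^bsub>M\<^esub> x \<in> carrier M"
    and smult_l_distr:
      "\<lbrakk>r \<in> carrier R; s \<in> carrier R; x \<in> carrier M\<rbrakk> \<Longrightarrow>
        (r \<oplus>\<^bsub>R\<^esub> s) \<odot>\<^bsub>M\<^esub> x = r \<odot>\<^bsub>M\<^esub> x \<oplus>\<^bsub>M\<^esub> s \<odot>\<^bsub>M\<^esub> x"
    and smult_r_distr:
      "\<lbrakk>r \<in> carrier R; x \<in> carrier M; y \<in> carrier M\<rbrakk> \<Longrightarrow>
        r \<odot>\<^bsub>M\<^esub> (x \<oplus>\<^bsub>M\<^esub> y) = r \<odot>\<^bsub>M\<^esub> x \<oplus>\<^bsub>M\<^esub> r \<odot>\<^bsub>M\<^esub> y"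
    and smult_assoc1:
      "\<lbrakk>r \<in> carrier R; s \<in> carrier R; x \<in> carrier M\<rbrakk> \<Longrightarrow>
        (r \<otimes>\<^bsub>R\<^esub> s) \<odot>\<^bsub>M\<^esub> x = r \<odot>\<^bsub>M\<^esub> (s \<odot>\<^bsub>M\<^esub> x)"
    and smult_one: "x \<in> carrier M \<Longrightarrow> \<one>\<^bsub>R\<^esub> \<odot>\<^bsub>M\<^esub> x = x"

definition lin_maps ::
  "('r, 'k) ring_scheme \<Rightarrow> ('r, 'a, 'm) module_scheme \<Rightarrow> ('r, 'b, 'n) module_scheme \<Rightarrow> ('a \<Rightarrow> 'b) set"
  where "lin_maps R M N =
    {h. h \<in> carrier M \<rightarrow> carrier N \<and>
        (\<forall>x\<in>carrier M. \<forall>y\<in>carrier M. h (x \<oplus>\<^bsub>M\<^esub> y) = h x \<oplus>\<^bsub>N\<^esub> h y) \<and>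
        (\<forall>r\<in>carrier R. \<forall>x\<in>carrier M. h (r \<odot>\<^bsub>M\<^esub> x) = r \<odot>\<^bsub>N\<^esub> h x)}"

definition mod_isomorphic ::
  "('r, 'k) ring_scheme \<Rightarrow> ('r, 'a, 'm) module_scheme \<Rightarrow> ('r, 'b, 'n) module_scheme \<Rightarrow> bool"
  where "mod_isomorphic R M N \<longleftrightarrow> (\<exists>h\<in>lin_maps R M N. bij_betw h (carrier M) (carrier N))"

definition zero_module :: "('r, unit) module"
  where "zero_module = \<lparr>carrier = UNIV, monoid.mult = (\<lambda>_ _. ()), one = (),
    zero = (), add = (\<lambda>_ _. ()), smult = (\<lambda>_ _. ())\<rparr>"

definition zero_map :: "('r, 'b, 'n) module_scheme \<Rightarrow> 'a \<Rightarrow> 'b"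
  where "zero_map N = (\<lambda>_. \<zero>\<^bsub>N\<^esub>)"

definition exact_at ::
  "('r, 'a, 'l) module_scheme \<Rightarrow> ('r, 'b, 'm) module_scheme \<Rightarrow> ('r, 'c, 'n) module_scheme \<Rightarrow>
    ('a \<Rightarrow> 'b) \<Rightarrow> ('b \<Rightarrow> 'c) \<Rightarrow> bool"
  where "exact_at L M N f g \<longleftrightarrow> f ` carrier L = a_kernel M N g"

text \<open>
  The quotient of \<open>M\<close> by a submodule \<open>U\<close>. The scalar multiplication sends \<open>x + U\<close> to \<open>r x + U\<close>; all
  terms of the union coincide when \<open>U\<close> is a submodule. The fields \<open>mult\<close> and \<open>one\<close> of the record play no role for modules.
\<close>

definition quot_module :: "('r, 'a, 'm) module_scheme \<Rightarrow> 'a set \<Rightarrow> ('r, 'a set) module"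
  where "quot_module M U = \<lparr>carrier = a_rcosets\<^bsub>M\<^esub> U, monoid.mult = undefined, one = undefined,
    zero = U, add = set_add M, smult = (\<lambda>r X. \<Union>x\<in>X. U +>\<^bsub>M\<^esub> (r \<odot>\<^bsub>M\<^esub> x))\<rparr>"

definition cokernel ::
  "('r, 'a, 'm) module_scheme \<Rightarrow> ('r, 'b, 'n) module_scheme \<Rightarrow> ('a \<Rightarrow> 'b) \<Rightarrow> ('r, 'b set) module"
  where "cokernel M N f = quot_module N (f ` carrier M)"

text \<open>
  The map induced by \<open>p : N \<rightarrow> N'\<close> from \<open>N/U\<close> to the cokernel of \<open>f' : M' \<rightarrow> N'\<close>: it sends
  \<open>x + U\<close> to \<open>p x + im f'\<close>, all terms of the union coincide when \<open>p\<close> maps \<open>U\<close> into the image of \<open>f'\<close>.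
\<close>

definition cok_map ::
  "('r, 'a, 'm) module_scheme \<Rightarrow> ('r, 'b, 'n) module_scheme \<Rightarrow> ('a \<Rightarrow> 'b) \<Rightarrow> ('c \<Rightarrow> 'b) \<Rightarrow>
    'c set \<Rightarrow> 'b set"
  where "cok_map M' N' f' p = (\<lambda>X. \<Union>x\<in>X. (f' ` carrier M') +>\<^bsub>N'\<^esub> p x)"

text \<open>
  The homology \<open>ker g / im f\<close> at \<open>M\<close> of \<open>L \<rightarrow> M \<rightarrow> N\<close>.
\<close>

definition homology ::
  "('r, 'a, 'l) module_scheme \<Rightarrow> ('r, 'b, 'm) module_scheme \<Rightarrow> ('r, 'c, 'n) module_scheme \<Rightarrow>
    ('a \<Rightarrow> 'b) \<Rightarrow> ('b \<Rightarrow> 'c) \<Rightarrow> ('r, 'b set) module"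
  where "homology L M N f g = quot_module (M\<lparr>carrier := a_kernel M N g\<rparr>) (f ` carrier L)"

text \<open>
  \<open>0 \<rightarrow> X \<rightarrow> Y \<rightarrow> Z \<rightarrow> 0\<close> is a complex of \<open>R\<close>-modules; the composites involving the
  outer zero maps vanish automatically.
\<close>

definition short_complex ::
  "('r, 'k) ring_scheme \<Rightarrow> ('r, 'a, 'l) module_scheme \<Rightarrow> ('r, 'b, 'm) module_scheme \<Rightarrow>
    ('r, 'c, 'n) module_scheme \<Rightarrow> ('a \<Rightarrow> 'b) \<Rightarrow> ('b \<Rightarrow> 'c) \<Rightarrow> bool"
  where "short_complex R X Y Z u v \<longleftrightarrow>
    left_module R X \<and> left_module R Y \<and> left_module R Z \<and>
    u \<in> lin_maps R X Y \<and> v \<in> lin_maps R Y Z \<and> (\<forall>x\<in>carrier X. v (u x) = \<zero>\<^bsub>Z\<^esub>)"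

definition isomorphic_homology ::
  "('r, 'k) ring_scheme \<Rightarrow>
    ('r, 'a, 'l) module_scheme \<Rightarrow> ('r, 'b, 'm) module_scheme \<Rightarrow> ('r, 'c, 'n) module_scheme \<Rightarrow>
    ('a \<Rightarrow> 'b) \<Rightarrow> ('b \<Rightarrow> 'c) \<Rightarrow>
    ('r, 'd, 'l2) module_scheme \<Rightarrow> ('r, 'e, 'm2) module_scheme \<Rightarrow> ('r, 'f, 'n2) module_scheme \<Rightarrow>
    ('d \<Rightarrow> 'e) \<Rightarrow> ('e \<Rightarrow> 'f) \<Rightarrow> bool"
  where "isomorphic_homology R X Y Z u v X' Y' Z' u' v' \<longleftrightarrow>
    mod_isomorphic R (homology zero_module X Y (zero_map X) u)
                     (homology zero_module X' Y' (zero_map X') u') \<and>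
    mod_isomorphic R (homology X Y Z u v) (homology X' Y' Z' u' v') \<and>
    mod_isomorphic R (homology Y Z zero_module v (zero_map (zero_module :: ('r, unit) module)))
                     (homology Y' Z' zero_module v' (zero_map (zero_module :: ('r, unit) module)))"

end

theory Submission
  imports Defs
begin

text \<open>
  A linear relation between two modules that is total on both sides and relates zero only to zero
  is the graph of an isomorphism. Each pair of homology modules is matched by a linear relation
  between representatives:
  \<open>a'' \<in> A''\<close> and \<open>c' \<in> C'\<close> correspond if some \<open>b \<in> B\<close> has \<open>\<beta> b = f'' a''\<close> and \<open>g b = \<gamma>' c'\<close>;
  \<open>b'' \<in> B''\<close> and \<open>c \<in> C\<close> correspond if \<open>g'' b'' = \<gamma> c\<close>;
  on \<open>C''\<close> the relation is equality, as both homology modules are \<open>C'' / (im \<gamma> + im g'')\<close>.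
  Diagram chases show that each relation is total on the cycles of both sides and that related
  cycles are simultaneously boundaries. The diagram is symmetric under transposition, so only half
  of these chases are needed.
\<close>

section \<open>Kernels, submodules, cosets and quotients of left modules\<close>

lemma mem_a_kernel: "x \<in> a_kernel M N h \<longleftrightarrow> x \<in> carrier M \<and> h x = \<zero>\<^bsub>N\<^esub>"
  by (simp add: a_kernel_def kernel_def)

text \<open>Serves to pass between a difference and a sum in the chases; the case
  \<open>z = 0\<close> turns a vanishing difference into an equality.\<close>

lemma (in abelian_group) minus_eq_iff:
  assumes "x \<in> carrier G" "y \<in> carrier G" "z \<in> carrier G"
  shows "x \<ominus> y = z \<longleftrightarrow> x = z \<oplus> y"
  using add.inv_solve_right[of z x y] assms by (auto simp: a_minus_def)

context left_module
begin

lemma smult_zero_left: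
  assumes "x \<in> carrier M"
  shows "\<zero>\<^bsub>R\<^esub> \<odot>\<^bsub>M\<^esub> x = \<zero>\<^bsub>M\<^esub>"
proof -
  have c: "\<zero>\<^bsub>R\<^esub> \<odot>\<^bsub>M\<^esub> x \<in> carrier M" using assms smult_closed by simp
  have "\<zero>\<^bsub>R\<^esub> \<odot>\<^bsub>M\<^esub> x \<oplus>\<^bsub>M\<^esub> \<zero>\<^bsub>R\<^esub> \<odot>\<^bsub>M\<^esub> x = \<zero>\<^bsub>R\<^esub> \<odot>\<^bsub>M\<^esub> x"
    using smult_l_distr[of "\<zero>\<^bsub>R\<^esub>" "\<zero>\<^bsub>R\<^esub>" x] assms by simp
  then show ?thesis using c M.add.l_cancel_one' by metis
qed

lemma smult_zero_right:
  assumes "r \<in> carrier R"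
  shows "r \<odot>\<^bsub>M\<^esub> \<zero>\<^bsub>M\<^esub> = \<zero>\<^bsub>M\<^esub>"
proof -
  have c: "r \<odot>\<^bsub>M\<^esub> \<zero>\<^bsub>M\<^esub> \<in> carrier M" using assms smult_closed by simp
  have "r \<odot>\<^bsub>M\<^esub> \<zero>\<^bsub>M\<^esub> \<oplus>\<^bsub>M\<^esub> r \<odot>\<^bsub>M\<^esub> \<zero>\<^bsub>M\<^esub> = r \<odot>\<^bsub>M\<^esub> \<zero>\<^bsub>M\<^esub>"
    using smult_r_distr[of r "\<zero>\<^bsub>M\<^esub>" "\<zero>\<^bsub>M\<^esub>"] assms by simp
  then show ?thesis using c M.add.l_cancel_one' by metis
qed

text \<open>Negation is multiplication by a scalar. Hence whatever respects addition and scalars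
  respects negatives; submodules, linear maps and linear relations all rely on this below.\<close>

lemma smult_minus_one:
  assumes "x \<in> carrier M"
  shows "(\<ominus>\<^bsub>R\<^esub> \<one>\<^bsub>R\<^esub>) \<odot>\<^bsub>M\<^esub> x = \<ominus>\<^bsub>M\<^esub> x"
proof -
  have "(\<ominus>\<^bsub>R\<^esub> \<one>\<^bsub>R\<^esub>) \<odot>\<^bsub>M\<^esub> x \<oplus>\<^bsub>M\<^esub> x = (\<ominus>\<^bsub>R\<^esub> \<one>\<^bsub>R\<^esub> \<oplus>\<^bsub>R\<^esub> \<one>\<^bsub>R\<^esub>) \<odot>\<^bsub>M\<^esub> x"
    using smult_l_distr[of "\<ominus>\<^bsub>R\<^esub> \<one>\<^bsub>R\<^esub>" "\<one>\<^bsub>R\<^esub>" x] assms smult_one by simp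
  also have "\<dots> = \<zero>\<^bsub>M\<^esub>" using assms smult_zero_left by (simp add: R.l_neg)
  finally show ?thesis using assms smult_closed M.minus_equality by (metis R.a_inv_closed R.one_closed)
qed

lemma submoduleI:
  assumes "H \<subseteq> carrier M" "\<zero>\<^bsub>M\<^esub> \<in> H"
    and "\<And>x y. \<lbrakk>x \<in> H; y \<in> H\<rbrakk> \<Longrightarrow> x \<oplus>\<^bsub>M\<^esub> y \<in> H"
    and smult: "\<And>r x. \<lbrakk>r \<in> carrier R; x \<in> H\<rbrakk> \<Longrightarrow> r \<odot>\<^bsub>M\<^esub> x \<in> H"
  shows "submodule H R M"
proof -
  have "\<ominus>\<^bsub>M\<^esub> x \<in> H" if "x \<in> H" for x
    using smult[of "\<ominus>\<^bsub>R\<^esub> \<one>\<^bsub>R\<^esub>" x] smult_minus_one[of x] that assms(1) by auto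
  then show ?thesis
    using assms by (auto intro!: submodule.intro subgroup.intro submodule_axioms.intro simp: a_inv_def)
qed

lemma submoduleD:
  assumes "submodule H R M"
  shows "H \<subseteq> carrier M" "\<zero>\<^bsub>M\<^esub> \<in> H"
    and "\<And>x y. \<lbrakk>x \<in> H; y \<in> H\<rbrakk> \<Longrightarrow> x \<oplus>\<^bsub>M\<^esub> y \<in> H"
    and "\<And>r x. \<lbrakk>r \<in> carrier R; x \<in> H\<rbrakk> \<Longrightarrow> r \<odot>\<^bsub>M\<^esub> x \<in> H"
    and "\<And>x. x \<in> H \<Longrightarrow> \<ominus>\<^bsub>M\<^esub> x \<in> H"
proof -
  interpret submodule H R M by fact
  show "H \<subseteq> carrier M" "\<zero>\<^bsub>M\<^esub> \<in> H" using subset one_closed by auto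
  show "\<And>x y. \<lbrakk>x \<in> H; y \<in> H\<rbrakk> \<Longrightarrow> x \<oplus>\<^bsub>M\<^esub> y \<in> H" using m_closed by auto
  show "\<And>r x. \<lbrakk>r \<in> carrier R; x \<in> H\<rbrakk> \<Longrightarrow> r \<odot>\<^bsub>M\<^esub> x \<in> H" using smult_closed by auto
  show "\<And>x. x \<in> H \<Longrightarrow> \<ominus>\<^bsub>M\<^esub> x \<in> H" using m_inv_closed by (auto simp: a_inv_def)
qed

lemma left_module_submodule:
  assumes "submodule H R M"
  shows "left_module R (M\<lparr>carrier := H\<rparr>)"
proof -
  note H = submoduleD[OF assms]
  have "abelian_group (M\<lparr>carrier := H\<rparr>)"
  proof (rule abelian_groupI)
    show "\<exists>y\<in>carrier (M\<lparr>carrier := H\<rparr>). y \<oplus>\<^bsub>M\<lparr>carrier := H\<rparr>\<^esub> x = \<zero>\<^bsub>M\<lparr>carrier := H\<rparr>\<^esub>"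
      if "x \<in> carrier (M\<lparr>carrier := H\<rparr>)" for x
      using H(1,5) that by (auto intro!: bexI[of _ "\<ominus>\<^bsub>M\<^esub> x"] simp: M.l_neg subset_iff)
  qed (use H in \<open>auto simp: subset_iff M.a_assoc M.a_comm M.a_lcomm\<close>)
  then show ?thesis
    using H R.ring_axioms
    by (auto intro!: left_module.intro left_module_axioms.intro
        simp: subset_iff smult_l_distr smult_r_distr smult_assoc1 smult_one)
qed

lemma coset_eq_iff:
  assumes "submodule U R M" "x \<in> carrier M" "y \<in> carrier M"
  shows "U +>\<^bsub>M\<^esub> x = U +>\<^bsub>M\<^esub> y \<longleftrightarrow> x \<ominus>\<^bsub>M\<^esub> y \<in> U"
proof -
  note U = submoduleD[OF assms(1)]
  have sg: "subgroup U (add_monoid M)" using assms(1) by (simp add: submodule_def)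
  have c: "x \<ominus>\<^bsub>M\<^esub> y \<in> carrier M" using assms by simp
  show ?thesis
  proof
    assume "U +>\<^bsub>M\<^esub> x = U +>\<^bsub>M\<^esub> y"
    then have "U +>\<^bsub>M\<^esub> (x \<ominus>\<^bsub>M\<^esub> y) = U"
      using M.a_coset_add_inv2 assms U(1) by (simp add: a_minus_def)
    then show "x \<ominus>\<^bsub>M\<^esub> y \<in> U" using M.a_coset_join1 c sg by blast
  next
    assume "x \<ominus>\<^bsub>M\<^esub> y \<in> U"
    then have "U +>\<^bsub>M\<^esub> (x \<ominus>\<^bsub>M\<^esub> y) = U" using M.a_coset_join2 c sg by blast
    then show "U +>\<^bsub>M\<^esub> x = U +>\<^bsub>M\<^esub> y"
      using M.a_coset_add_inv1 assms U(1) by (simp add: a_minus_def)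
  qed
qed

lemma coset_eq_self_iff:
  assumes "submodule U R M" "x \<in> carrier M"
  shows "U +>\<^bsub>M\<^esub> x = U \<longleftrightarrow> x \<in> U"
  using coset_eq_iff[OF assms M.zero_closed] assms(2) submoduleD(1)[OF assms(1)]
    M.minus_equality[of "\<zero>\<^bsub>M\<^esub>" "\<zero>\<^bsub>M\<^esub>"]
  by (simp add: a_minus_def)

text \<open>Two representatives of one coset differ by an element of \<open>U\<close>, so this is
  what makes all terms of the unions in \<open>quot_module\<close> and \<open>cok_map\<close>
  coincide.\<close>

lemma coset_absorb:
  assumes "submodule U R M" "x \<in> carrier M" "u \<in> U"
  shows "U +>\<^bsub>M\<^esub> (u \<oplus>\<^bsub>M\<^esub> x) = U +>\<^bsub>M\<^esub> x"
proof -
  have u: "u \<in> carrier M" using submoduleD(1)[OF assms(1)] assms(3) by auto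
  have "(u \<oplus>\<^bsub>M\<^esub> x) \<ominus>\<^bsub>M\<^esub> x = u"
    using u assms(2) by (simp add: a_minus_def M.a_assoc M.r_neg)
  then show ?thesis using coset_eq_iff[OF assms(1)] assms u by simp
qed

text \<open>Reduces calculation in the quotient to calculation with representatives. For the scalar
  multiplication, y = u + x with u in \<open>U\<close> gives r y = r u + r x, and the coset absorbs
  r u.\<close>

lemma
  assumes "submodule U R M"
  shows quot_module_carrier: "carrier (quot_module M U) = (\<lambda>x. U +>\<^bsub>M\<^esub> x) ` carrier M"
    and quot_module_zero: "\<zero>\<^bsub>quot_module M U\<^esub> = U"
    and quot_module_add: "\<And>x y. \<lbrakk>x \<in> carrier M; y \<in> carrier M\<rbrakk> \<Longrightarrow>
          (U +>\<^bsub>M\<^esub> x) \<oplus>\<^bsub>quot_module M U\<^esub> (U +>\<^bsub>M\<^esub> y) = U +>\<^bsub>M\<^esub> (x \<oplus>\<^bsub>M\<^esub> y)"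
    and quot_module_smult: "\<And>r x. \<lbrakk>r \<in> carrier R; x \<in> carrier M\<rbrakk> \<Longrightarrow>
          r \<odot>\<^bsub>quot_module M U\<^esub> (U +>\<^bsub>M\<^esub> x) = U +>\<^bsub>M\<^esub> (r \<odot>\<^bsub>M\<^esub> x)"
proof -
  note U = submoduleD[OF assms]
  interpret U: abelian_subgroup U M
    by (rule abelian_subgroupI3)
       (use assms M.abelian_group_axioms in \<open>auto simp: submodule_def additive_subgroup_def\<close>)
  show "carrier (quot_module M U) = (\<lambda>x. U +>\<^bsub>M\<^esub> x) ` carrier M"
    by (auto simp: quot_module_def A_RCOSETS_def')
  show "\<zero>\<^bsub>quot_module M U\<^esub> = U" by (simp add: quot_module_def)
  show "(U +>\<^bsub>M\<^esub> x) \<oplus>\<^bsub>quot_module M U\<^esub> (U +>\<^bsub>M\<^esub> y) = U +>\<^bsub>M\<^esub> (x \<oplus>\<^bsub>M\<^esub> y)"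
    if "x \<in> carrier M" "y \<in> carrier M" for x y
    using U.a_rcos_sum that by (simp add: quot_module_def)
  show "r \<odot>\<^bsub>quot_module M U\<^esub> (U +>\<^bsub>M\<^esub> x) = U +>\<^bsub>M\<^esub> (r \<odot>\<^bsub>M\<^esub> x)"
    if "r \<in> carrier R" "x \<in> carrier M" for r x
  proof -
    have "U +>\<^bsub>M\<^esub> (r \<odot>\<^bsub>M\<^esub> y) = U +>\<^bsub>M\<^esub> (r \<odot>\<^bsub>M\<^esub> x)" if y: "y \<in> U +>\<^bsub>M\<^esub> x" for y
    proof -
      obtain u where u: "u \<in> U" "y = u \<oplus>\<^bsub>M\<^esub> x" using y by (auto simp: a_r_coset_def')
      then have "r \<odot>\<^bsub>M\<^esub> y = r \<odot>\<^bsub>M\<^esub> u \<oplus>\<^bsub>M\<^esub> r \<odot>\<^bsub>M\<^esub> x"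
        using smult_r_distr \<open>r \<in> carrier R\<close> \<open>x \<in> carrier M\<close> U(1) by blast
      then show ?thesis
        using coset_absorb[OF assms] smult_closed U(4) u(1) that \<open>r \<in> carrier R\<close> \<open>x \<in> carrier M\<close> by simp
    qed
    \<comment> \<open>The union runs over a nonempty coset, so it equals the common value of its
      terms.\<close>
    moreover have "x \<in> U +>\<^bsub>M\<^esub> x" using U.a_rcos_self that by simp
    ultimately have "(\<Union>y\<in>U +>\<^bsub>M\<^esub> x. U +>\<^bsub>M\<^esub> (r \<odot>\<^bsub>M\<^esub> y)) = U +>\<^bsub>M\<^esub> (r \<odot>\<^bsub>M\<^esub> x)"
      by blast
    then show ?thesis by (simp add: quot_module_def)
  qed
qed

lemma left_module_quot:
  assumes U: "submodule U R M"
  shows "left_module R (quot_module M U)"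
proof -
  note [simp] = quot_module_carrier[OF U] quot_module_add[OF U] quot_module_smult[OF U] smult_closed
  \<comment> \<open>With zero written as a coset, every module axiom can be checked on
    representatives.\<close>
  have Z: "\<zero>\<^bsub>quot_module M U\<^esub> = U +>\<^bsub>M\<^esub> \<zero>\<^bsub>M\<^esub>"
    using submoduleD(1)[OF U] quot_module_zero[OF U] by simp
  have "abelian_group (quot_module M U)"
  proof (rule abelian_groupI)
    fix X assume "X \<in> carrier (quot_module M U)"
    then obtain x where x: "x \<in> carrier M" "X = U +>\<^bsub>M\<^esub> x" by auto
    then show "\<exists>Y\<in>carrier (quot_module M U). Y \<oplus>\<^bsub>quot_module M U\<^esub> X = \<zero>\<^bsub>quot_module M U\<^esub>"
      unfolding Z by (auto intro!: bexI[of _ "\<ominus>\<^bsub>M\<^esub> x"] simp: M.l_neg)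
  next
    fix X Y assume "X \<in> carrier (quot_module M U)" "Y \<in> carrier (quot_module M U)"
    then show "X \<oplus>\<^bsub>quot_module M U\<^esub> Y = Y \<oplus>\<^bsub>quot_module M U\<^esub> X"
      using M.a_comm by auto
  qed (auto simp: Z M.a_assoc)
  then show ?thesis
    using R.ring_axioms
    by (auto intro!: left_module.intro left_module_axioms.intro
        simp: smult_l_distr smult_r_distr smult_assoc1 smult_one)
qed

lemma quot_proj_lin:
  assumes "submodule U R M"
  shows "(\<lambda>x. U +>\<^bsub>M\<^esub> x) \<in> lin_maps R M (quot_module M U)"
  unfolding lin_maps_def
  by (auto simp: quot_module_carrier[OF assms] quot_module_add[OF assms] quot_module_smult[OF assms])

end

section \<open>Linear maps, their kernels, images and cokernels\<close>

locale lin_map = M: left_module R M + N: left_module R N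
  for R (structure) and M (structure) and N (structure) and h +
  assumes lin: "h \<in> lin_maps R M N"
begin

lemma map_closed: "x \<in> carrier M \<Longrightarrow> h x \<in> carrier N"
  and map_add: "\<lbrakk>x \<in> carrier M; y \<in> carrier M\<rbrakk> \<Longrightarrow> h (x \<oplus>\<^bsub>M\<^esub> y) = h x \<oplus>\<^bsub>N\<^esub> h y"
  and map_smult: "\<lbrakk>r \<in> carrier R; x \<in> carrier M\<rbrakk> \<Longrightarrow> h (r \<odot>\<^bsub>M\<^esub> x) = r \<odot>\<^bsub>N\<^esub> h x"
  using lin by (auto simp: lin_maps_def)

text \<open>Zero is a multiple by the scalar 0, as negatives are multiples by -1, so compatibility
  with scalars carries both over.\<close>

lemma map_zero: "h \<zero>\<^bsub>M\<^esub> = \<zero>\<^bsub>N\<^esub>"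
  using map_smult[of "\<zero>\<^bsub>R\<^esub>" "\<zero>\<^bsub>M\<^esub>"] M.smult_zero_left N.smult_zero_left map_closed by simp

lemma map_minus: "x \<in> carrier M \<Longrightarrow> h (\<ominus>\<^bsub>M\<^esub> x) = \<ominus>\<^bsub>N\<^esub> h x"
  using map_smult[of "\<ominus>\<^bsub>R\<^esub> \<one>\<^bsub>R\<^esub>" x] M.smult_minus_one N.smult_minus_one map_closed by simp

lemma map_diff: "\<lbrakk>x \<in> carrier M; y \<in> carrier M\<rbrakk> \<Longrightarrow> h (x \<ominus>\<^bsub>M\<^esub> y) = h x \<ominus>\<^bsub>N\<^esub> h y"
  by (simp add: a_minus_def map_add map_minus)

lemma submodule_kernel: "submodule (a_kernel M N h) R M"
  by (rule M.submoduleI)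
     (auto simp: mem_a_kernel map_zero map_add map_smult M.smult_closed N.smult_zero_right)

lemma submodule_image:
  assumes "submodule U R M"
  shows "submodule (h ` U) R N"
proof (rule N.submoduleI)
  note U = M.submoduleD[OF assms]
  show "h ` U \<subseteq> carrier N" using U(1) map_closed by auto
  show "\<zero>\<^bsub>N\<^esub> \<in> h ` U" using U(2) map_zero by (metis imageI)
  show "x \<oplus>\<^bsub>N\<^esub> y \<in> h ` U" if "x \<in> h ` U" "y \<in> h ` U" for x y
    using that U(1,3) map_add by (auto simp: image_iff subset_iff) metis
  show "r \<odot>\<^bsub>N\<^esub> x \<in> h ` U" if "r \<in> carrier R" "x \<in> h ` U" for r x
    using that U(1,4) map_smult by (auto simp: image_iff subset_iff) metis
qed

lemma submodule_range: "submodule (h ` carrier M) R N"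
  by (rule submodule_image, rule M.submoduleI) (auto simp: M.smult_closed)

lemma left_module_cokernel: "left_module R (cokernel M N h)"
  unfolding cokernel_def by (rule N.left_module_quot[OF submodule_range])

lemma
  shows cokernel_carrier: "carrier (cokernel M N h) = (\<lambda>x. h ` carrier M +>\<^bsub>N\<^esub> x) ` carrier N"
    and cokernel_zero: "\<zero>\<^bsub>cokernel M N h\<^esub> = h ` carrier M"
  unfolding cokernel_def
  by (rule N.quot_module_carrier[OF submodule_range] N.quot_module_zero[OF submodule_range])+

end

lemma lin_mapI:
  "\<lbrakk>left_module R M; left_module R N; h \<in> lin_maps R M N\<rbrakk> \<Longrightarrow> lin_map R M N h"
  by (simp add: lin_map_def lin_map_axioms_def)

lemma left_module_zero_module:
  assumes "ring R"
  shows "left_module R (zero_module :: ('r, unit) module)"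
proof -
  have "abelian_group (zero_module :: ('r, unit) module)"
    by (rule abelian_groupI) (auto simp: zero_module_def)
  then show ?thesis
    using assms by (auto intro!: left_module.intro left_module_axioms.intro simp: zero_module_def)
qed

lemma zero_map_lin:
  assumes "left_module R N"
  shows "zero_map N \<in> lin_maps R M N"
proof -
  interpret left_module R N by fact
  show ?thesis by (auto simp: lin_maps_def zero_map_def smult_zero_right)
qed

section \<open>Isomorphisms obtained from linear relations\<close>

text \<open>Closure under addition and the scalar -1 makes \<open>T\<close> closed under
  differences. As \<open>T\<close> relates zero only to zero on either side, two related pairs agree
  in one component exactly when they agree in the other, so \<open>T\<close> is the graph of a
  bijection; its closure properties make that bijection linear.\<close>

lemma mod_isomorphic_by_relation:
  assumes P: "left_module R P" and Q: "left_module R Q"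
    and dom: "fst ` T = carrier P" and ran: "snd ` T = carrier Q"
    and add: "\<And>x y x' y'. \<lbrakk>(x, y) \<in> T; (x', y') \<in> T\<rbrakk> \<Longrightarrow> (x \<oplus>\<^bsub>P\<^esub> x', y \<oplus>\<^bsub>Q\<^esub> y') \<in> T"
    and smult: "\<And>r x y. \<lbrakk>r \<in> carrier R; (x, y) \<in> T\<rbrakk> \<Longrightarrow> (r \<odot>\<^bsub>P\<^esub> x, r \<odot>\<^bsub>Q\<^esub> y) \<in> T"
    and zero: "\<And>x y. (x, y) \<in> T \<Longrightarrow> x = \<zero>\<^bsub>P\<^esub> \<longleftrightarrow> y = \<zero>\<^bsub>Q\<^esub>"
  shows "mod_isomorphic R P Q"
proof -
  interpret P: left_module R P by fact
  interpret Q: left_module R Q by fact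
  have car: "x \<in> carrier P" "y \<in> carrier Q" if "(x, y) \<in> T" for x y
    using dom ran that by force+
  have eq: "x = x' \<longleftrightarrow> y = y'" if "(x, y) \<in> T" "(x', y') \<in> T" for x y x' y'
  proof -
    have "(\<ominus>\<^bsub>P\<^esub> x', \<ominus>\<^bsub>Q\<^esub> y') \<in> T"
      using smult[of "\<ominus>\<^bsub>R\<^esub> \<one>\<^bsub>R\<^esub>" x' y'] that(2) car[OF that(2)] P.smult_minus_one Q.smult_minus_one by simp
    then have "x \<ominus>\<^bsub>P\<^esub> x' = \<zero>\<^bsub>P\<^esub> \<longleftrightarrow> y \<ominus>\<^bsub>Q\<^esub> y' = \<zero>\<^bsub>Q\<^esub>"
      using zero add that(1) by (simp add: a_minus_def)
    then show ?thesis
      using car[OF that(1)] car[OF that(2)] by (simp add: P.minus_eq_iff Q.minus_eq_iff)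
  qed
  \<comment> \<open>By \<open>eq\<close> the relation is single-valued, so the choice is forced on
    the carrier of \<open>P\<close>.\<close>
  define h where "h x = (SOME y. (x, y) \<in> T)" for x
  have h: "(x, h x) \<in> T" if "x \<in> carrier P" for x
  proof -
    have "x \<in> fst ` T" using that dom by blast
    then obtain y where "(x, y) \<in> T" by auto
    then show ?thesis unfolding h_def by (rule someI)
  qed
  have h_eq: "h x = y" if "(x, y) \<in> T" for x y
    using eq[OF h[OF car(1)[OF that]] that] by simp
  have "h \<in> lin_maps R P Q"
    unfolding lin_maps_def
  proof (intro CollectI conjI ballI funcsetI)
    show "h x \<in> carrier Q" if "x \<in> carrier P" for x
      using car(2)[OF h[OF that]] .
    show "h (x \<oplus>\<^bsub>P\<^esub> y) = h x \<oplus>\<^bsub>Q\<^esub> h y" if "x \<in> carrier P" "y \<in> carrier P" for x y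
      using that by (intro h_eq add h)
    show "h (r \<odot>\<^bsub>P\<^esub> x) = r \<odot>\<^bsub>Q\<^esub> h x" if "r \<in> carrier R" "x \<in> carrier P" for r x
      using that by (intro h_eq smult h)
  qed
  moreover have "bij_betw h (carrier P) (carrier Q)"
  proof (rule bij_betw_imageI)
    show "inj_on h (carrier P)"
    proof (rule inj_onI)
      fix x y assume "x \<in> carrier P" "y \<in> carrier P" "h x = h y"
      then show "x = y" using eq[OF h h, of x y] by blast
    qed
    show "h ` carrier P = carrier Q"
    proof (intro equalityI subsetI)
      fix y assume "y \<in> h ` carrier P"
      then show "y \<in> carrier Q" using car(2)[OF h] by blast
    next
      fix y assume "y \<in> carrier Q"
      then have "y \<in> snd ` T" using ran by blast
      then obtain x where "(x, y) \<in> T" by auto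
      then show "y \<in> h ` carrier P" using car(1) h_eq by blast
    qed
  qed
  ultimately show ?thesis unfolding mod_isomorphic_def by blast
qed

section \<open>Maps induced on cokernels\<close>

text \<open>The square enters only through the inclusion that makes the induced map well defined:
  \<open>p\<close> carries the image of \<open>f\<close> into the image of
  \<open>f'\<close>.\<close>

locale cok_square = f: lin_map R M N f + f': lin_map R M' N' f' + p: lin_map R N N' p
  for R (structure) and M (structure) and N (structure) and f
    and M' (structure) and N' (structure) and f' and p +
  assumes square: "\<And>x. x \<in> carrier M \<Longrightarrow> p (f x) \<in> f' ` carrier M'"
begin

lemma cok_map_coset:
  assumes "x \<in> carrier N"
  shows "cok_map M' N' f' p (f ` carrier M +>\<^bsub>N\<^esub> x) = f' ` carrier M' +>\<^bsub>N'\<^esub> p x"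
proof -
  have "f' ` carrier M' +>\<^bsub>N'\<^esub> p y = f' ` carrier M' +>\<^bsub>N'\<^esub> p x"
    if "y \<in> f ` carrier M +>\<^bsub>N\<^esub> x" for y
  proof -
    obtain m where m: "m \<in> carrier M" "y = f m \<oplus>\<^bsub>N\<^esub> x"
      using \<open>y \<in> _\<close> by (auto simp: a_r_coset_def')
    then have "p y = p (f m) \<oplus>\<^bsub>N'\<^esub> p x" using p.map_add f.map_closed assms by simp
    then show ?thesis
      using f'.N.coset_absorb[OF f'.submodule_range] p.map_closed square m(1) assms by simp
  qed
  \<comment> \<open>Zero in \<open>M\<close> shows that the coset contains its own representative,
    so the union of equal terms is not empty.\<close>
  moreover have "x \<in> f ` carrier M +>\<^bsub>N\<^esub> x"
    using f.map_zero assms by (force simp: a_r_coset_def' intro!: image_eqI[of _ _ "\<zero>\<^bsub>M\<^esub>"])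
  ultimately show ?thesis unfolding cok_map_def by blast
qed

lemma cok_map_lin: "cok_map M' N' f' p \<in> lin_maps R (cokernel M N f) (cokernel M' N' f')"
  using cok_map_coset p.map_closed p.map_add p.map_smult f.N.smult_closed
  unfolding lin_maps_def cokernel_def
  by (auto simp: f.N.quot_module_carrier[OF f.submodule_range]
      f.N.quot_module_add[OF f.submodule_range] f.N.quot_module_smult[OF f.submodule_range]
      f'.N.quot_module_carrier[OF f'.submodule_range]
      f'.N.quot_module_add[OF f'.submodule_range] f'.N.quot_module_smult[OF f'.submodule_range])

text \<open>Together with \<open>coset_in_cok_map_range_iff\<close> this describes kernel and image
  of the induced map by elements of the original modules, so that the chases can be carried out in
  the diagram itself.\<close>

lemma cok_map_eq_zero_iff:
  assumes "x \<in> carrier N"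
  shows "cok_map M' N' f' p (f ` carrier M +>\<^bsub>N\<^esub> x) = \<zero>\<^bsub>cokernel M' N' f'\<^esub> \<longleftrightarrow>
    p x \<in> f' ` carrier M'"
  using assms p.map_closed
  by (simp add: cok_map_coset f'.cokernel_zero f'.N.coset_eq_self_iff[OF f'.submodule_range])

text \<open>Cosets of the image of \<open>f'\<close> agree when their representatives differ by some
  \<open>f' m\<close>. The order of the summands fixed here is the one that the chases have to
  match.\<close>

lemma coset_in_cok_map_range_iff:
  assumes "y \<in> carrier N'"
  shows "f' ` carrier M' +>\<^bsub>N'\<^esub> y \<in> cok_map M' N' f' p ` carrier (cokernel M N f) \<longleftrightarrow>
    (\<exists>x\<in>carrier N. \<exists>m\<in>carrier M'. y = f' m \<oplus>\<^bsub>N'\<^esub> p x)"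
proof -
  have "f' ` carrier M' +>\<^bsub>N'\<^esub> y = f' ` carrier M' +>\<^bsub>N'\<^esub> p x \<longleftrightarrow>
      (\<exists>m\<in>carrier M'. y = f' m \<oplus>\<^bsub>N'\<^esub> p x)" if x: "x \<in> carrier N" for x
  proof -
    have "f' ` carrier M' +>\<^bsub>N'\<^esub> y = f' ` carrier M' +>\<^bsub>N'\<^esub> p x \<longleftrightarrow>
        (\<exists>m\<in>carrier M'. y \<ominus>\<^bsub>N'\<^esub> p x = f' m)"
      unfolding f'.N.coset_eq_iff[OF f'.submodule_range assms p.map_closed[OF x]] by blast
    then show ?thesis
      using f'.N.minus_eq_iff[OF assms p.map_closed[OF x] f'.map_closed] by simp
  qed
  then show ?thesis by (auto simp: f.cokernel_carrier cok_map_coset image_iff)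
qed

end

section \<open>Homology and representatives of homology classes\<close>

locale three_term_complex = u: lin_map R L M u + v: lin_map R M N v
  for R (structure) and L (structure) and M (structure) and N (structure) and u v +
  assumes comp_zero: "\<And>x. x \<in> carrier L \<Longrightarrow> v (u x) = \<zero>\<^bsub>N\<^esub>"
begin

sublocale K: left_module R "M\<lparr>carrier := a_kernel M N v\<rparr>"
  by (rule u.N.left_module_submodule[OF v.submodule_kernel])

text \<open>Boundaries are cycles by \<open>comp_zero\<close>; the closure properties come from the
  image being a submodule of \<open>M\<close>.\<close>

lemma submodule_boundaries: "submodule (u ` carrier L) R (M\<lparr>carrier := a_kernel M N v\<rparr>)"
  by (rule K.submoduleI)
     (use u.N.submoduleD[OF u.submodule_range] in \<open>auto simp: mem_a_kernel u.map_closed comp_zero\<close>)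

text \<open>Forming a coset involves only the addition, which the kernel shares with
  \<open>M\<close>. Homology classes can therefore be written as cosets in \<open>M\<close>.\<close>

lemma coset_kernel: "u ` carrier L +>\<^bsub>M\<lparr>carrier := a_kernel M N v\<rparr>\<^esub> x = u ` carrier L +>\<^bsub>M\<^esub> x"
  by (simp add: a_r_coset_def')

lemma left_module_homology: "left_module R (homology L M N u v)"
  unfolding homology_def by (rule K.left_module_quot[OF submodule_boundaries])

lemma homology_class_lin:
  "(\<lambda>x. u ` carrier L +>\<^bsub>M\<^esub> x) \<in> lin_maps R (M\<lparr>carrier := a_kernel M N v\<rparr>) (homology L M N u v)"
  using K.quot_proj_lin[OF submodule_boundaries] unfolding homology_def coset_kernel .

lemma homology_carrier:
  "carrier (homology L M N u v) = (\<lambda>x. u ` carrier L +>\<^bsub>M\<^esub> x) ` a_kernel M N v"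
  using K.quot_module_carrier[OF submodule_boundaries] unfolding homology_def coset_kernel by simp

lemma homology_class_eq_zero_iff:
  assumes "x \<in> carrier M"
  shows "u ` carrier L +>\<^bsub>M\<^esub> x = \<zero>\<^bsub>homology L M N u v\<^esub> \<longleftrightarrow> x \<in> u ` carrier L"
  using u.N.coset_eq_self_iff[OF u.submodule_range assms] by (simp add: homology_def quot_module_def)

end

text \<open>All homology modules to be compared are taken at a cokernel, so a class is a coset of
  cosets. This setting represents it by an element of \<open>M\<close> itself: \<open>bar\<close>
  passes to the cokernel, \<open>cls\<close> on to homology, and \<open>cycles\<close> collects the
  elements of \<open>M\<close> that represent cycles.\<close>

locale homology_at_cokernel = f: lin_map R M0 M f + three_term_complex R L "cokernel M0 M f" N u v
  for R (structure) and M0 (structure) and M (structure) and f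
    and L (structure) and N (structure) and u v
begin

definition bar where "bar x = f ` carrier M0 +>\<^bsub>M\<^esub> x"

definition cls where "cls x = u ` carrier L +>\<^bsub>cokernel M0 M f\<^esub> bar x"

definition cycles where "cycles = {x \<in> carrier M. v (bar x) = \<zero>\<^bsub>N\<^esub>}"

lemma bar_lin: "bar \<in> lin_maps R M (cokernel M0 M f)"
  using f.N.quot_proj_lin[OF f.submodule_range] unfolding bar_def[abs_def] cokernel_def .

sublocale bar: lin_map R M "cokernel M0 M f" bar
  by (rule lin_mapI[OF f.N.left_module_axioms f.left_module_cokernel bar_lin])

text \<open>The projection \<open>bar\<close> is surjective, so every cycle in the cokernel lifts to
  \<open>M\<close>.\<close>

lemma bar_cycles: "bar ` cycles = a_kernel (cokernel M0 M f) N v"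
proof (intro equalityI subsetI)
  fix X assume "X \<in> bar ` cycles"
  then show "X \<in> a_kernel (cokernel M0 M f) N v"
    using bar.map_closed by (auto simp: cycles_def mem_a_kernel)
next
  fix X assume "X \<in> a_kernel (cokernel M0 M f) N v"
  then have X: "X \<in> bar ` carrier M" "v X = \<zero>\<^bsub>N\<^esub>"
    unfolding mem_a_kernel f.cokernel_carrier bar_def[abs_def] by blast+
  then show "X \<in> bar ` cycles" by (auto simp: cycles_def)
qed

lemma cls_cycles: "cls ` cycles = carrier (homology L (cokernel M0 M f) N u v)"
  unfolding homology_carrier bar_cycles[symmetric] image_image cls_def[abs_def] ..

lemma cls_add:
  assumes "x \<in> cycles" "y \<in> cycles"
  shows "cls (x \<oplus>\<^bsub>M\<^esub> y) = cls x \<oplus>\<^bsub>homology L (cokernel M0 M f) N u v\<^esub> cls y"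
proof -
  have "bar x \<in> a_kernel (cokernel M0 M f) N v" "bar y \<in> a_kernel (cokernel M0 M f) N v"
    using assms bar_cycles by blast+
  then show ?thesis
    using assms homology_class_lin by (auto simp: lin_maps_def cls_def cycles_def bar.map_add)
qed

lemma cls_smult:
  assumes "r \<in> carrier R" "x \<in> cycles"
  shows "cls (r \<odot>\<^bsub>M\<^esub> x) = r \<odot>\<^bsub>homology L (cokernel M0 M f) N u v\<^esub> cls x"
proof -
  have "bar x \<in> a_kernel (cokernel M0 M f) N v"
    using assms bar_cycles by blast
  then show ?thesis
    using assms homology_class_lin by (auto simp: lin_maps_def cls_def cycles_def bar.map_smult)
qed

lemma cls_eq_zero_iff:
  assumes "x \<in> cycles"
  shows "cls x = \<zero>\<^bsub>homology L (cokernel M0 M f) N u v\<^esub> \<longleftrightarrow> bar x \<in> u ` carrier L"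
  unfolding cls_def
  by (rule homology_class_eq_zero_iff) (use assms in \<open>simp add: cycles_def bar.map_closed\<close>)

end

text \<open>The image of \<open>T\<close> under the two class maps is a linear relation between the
  homology modules. Every class has a cycle as representative, so \<open>dom\<close> and
  \<open>ran\<close> make this relation total on both sides, and \<open>boundary\<close> makes it
  relate zero only to zero.\<close>

lemma homology_isomorphic_by_relation:
  assumes H: "homology_at_cokernel R M0 M f L N u v"
    and H': "homology_at_cokernel R M0' M' f' L' N' u' v'"
    and sub: "T \<subseteq> carrier M \<times> carrier M'"
    and dom: "\<And>x. x \<in> carrier M \<Longrightarrow>
      v (f ` carrier M0 +>\<^bsub>M\<^esub> x) = \<zero>\<^bsub>N\<^esub> \<longleftrightarrow> (\<exists>y. (x, y) \<in> T)"
    and ran: "\<And>y. y \<in> carrier M' \<Longrightarrow>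
      v' (f' ` carrier M0' +>\<^bsub>M'\<^esub> y) = \<zero>\<^bsub>N'\<^esub> \<longleftrightarrow> (\<exists>x. (x, y) \<in> T)"
    and add: "\<And>x y x' y'. \<lbrakk>(x, y) \<in> T; (x', y') \<in> T\<rbrakk> \<Longrightarrow> (x \<oplus>\<^bsub>M\<^esub> x', y \<oplus>\<^bsub>M'\<^esub> y') \<in> T"
    and smult: "\<And>r x y. \<lbrakk>r \<in> carrier R; (x, y) \<in> T\<rbrakk> \<Longrightarrow> (r \<odot>\<^bsub>M\<^esub> x, r \<odot>\<^bsub>M'\<^esub> y) \<in> T"
    and boundary: "\<And>x y. (x, y) \<in> T \<Longrightarrow>
      f ` carrier M0 +>\<^bsub>M\<^esub> x \<in> u ` carrier L \<longleftrightarrow> f' ` carrier M0' +>\<^bsub>M'\<^esub> y \<in> u' ` carrier L'"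
  shows "mod_isomorphic R (homology L (cokernel M0 M f) N u v) (homology L' (cokernel M0' M' f') N' u' v')"
proof -
  interpret H: homology_at_cokernel R M0 M f L N u v by fact
  interpret H': homology_at_cokernel R M0' M' f' L' N' u' v' by fact
  have cyc: "x \<in> H.cycles" "y \<in> H'.cycles" if "(x, y) \<in> T" for x y
    using dom ran sub that by (auto simp: H.cycles_def H'.cycles_def H.bar_def H'.bar_def)
  \<comment> \<open>The projections of \<open>T\<close> are exactly the sets of cycles, which the
    class maps send onto homology.\<close>
  have fst: "fst ` T = H.cycles"
    using dom sub by (force simp: H.cycles_def H.bar_def image_iff)
  have snd: "snd ` T = H'.cycles"
    using ran sub by (force simp: H'.cycles_def H'.bar_def image_iff)
  show ?thesis
  proof (rule mod_isomorphic_by_relation[where T = "map_prod H.cls H'.cls ` T"])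
    show "fst ` map_prod H.cls H'.cls ` T = carrier (homology L (cokernel M0 M f) N u v)"
      by (simp flip: fst H.cls_cycles add: image_image)
    show "snd ` map_prod H.cls H'.cls ` T = carrier (homology L' (cokernel M0' M' f') N' u' v')"
      by (simp flip: snd H'.cls_cycles add: image_image)
  next
    fix X Y X' Y' assume "(X, Y) \<in> map_prod H.cls H'.cls ` T" "(X', Y') \<in> map_prod H.cls H'.cls ` T"
    then obtain x y x' y' where xy: "(x, y) \<in> T" "(x', y') \<in> T"
      and XY: "X = H.cls x" "Y = H'.cls y" "X' = H.cls x'" "Y' = H'.cls y'" by auto
    have "(X \<oplus>\<^bsub>homology L (cokernel M0 M f) N u v\<^esub> X',
        Y \<oplus>\<^bsub>homology L' (cokernel M0' M' f') N' u' v'\<^esub> Y') =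
      map_prod H.cls H'.cls (x \<oplus>\<^bsub>M\<^esub> x', y \<oplus>\<^bsub>M'\<^esub> y')"
      by (simp add: XY H.cls_add[OF cyc(1)[OF xy(1)] cyc(1)[OF xy(2)]]
          H'.cls_add[OF cyc(2)[OF xy(1)] cyc(2)[OF xy(2)]])
    then show "(X \<oplus>\<^bsub>homology L (cokernel M0 M f) N u v\<^esub> X',
        Y \<oplus>\<^bsub>homology L' (cokernel M0' M' f') N' u' v'\<^esub> Y') \<in> map_prod H.cls H'.cls ` T"
      using add[OF xy] by (metis imageI)
  next
    fix r X Y assume r: "r \<in> carrier R" and "(X, Y) \<in> map_prod H.cls H'.cls ` T"
    then obtain x y where xy: "(x, y) \<in> T" and XY: "X = H.cls x" "Y = H'.cls y" by auto
    have "(r \<odot>\<^bsub>homology L (cokernel M0 M f) N u v\<^esub> X,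
        r \<odot>\<^bsub>homology L' (cokernel M0' M' f') N' u' v'\<^esub> Y) =
      map_prod H.cls H'.cls (r \<odot>\<^bsub>M\<^esub> x, r \<odot>\<^bsub>M'\<^esub> y)"
      by (simp add: XY H.cls_smult[OF r cyc(1)[OF xy]] H'.cls_smult[OF r cyc(2)[OF xy]])
    then show "(r \<odot>\<^bsub>homology L (cokernel M0 M f) N u v\<^esub> X,
        r \<odot>\<^bsub>homology L' (cokernel M0' M' f') N' u' v'\<^esub> Y) \<in> map_prod H.cls H'.cls ` T"
      using smult[OF r xy] by (metis imageI)
  next
    fix X Y assume "(X, Y) \<in> map_prod H.cls H'.cls ` T"
    then obtain x y where xy: "(x, y) \<in> T" and XY: "X = H.cls x" "Y = H'.cls y" by auto
    show "X = \<zero>\<^bsub>homology L (cokernel M0 M f) N u v\<^esub> \<longleftrightarrow>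
        Y = \<zero>\<^bsub>homology L' (cokernel M0' M' f') N' u' v'\<^esub>"
      unfolding XY H.cls_eq_zero_iff[OF cyc(1)[OF xy]] H'.cls_eq_zero_iff[OF cyc(2)[OF xy]]
      using boundary[OF xy] unfolding H.bar_def H'.bar_def .
  qed (rule H.left_module_homology H'.left_module_homology)+
qed

section \<open>Short complexes of cokernels and their three positions\<close>

text \<open>The composite sends the coset of x to that of \<open>q (p x)\<close>, which is zero and
  hence lies in the image of \<open>f''\<close>.\<close>

lemma short_complex_cok_map:
  assumes P: "cok_square R M N f M' N' f' p" and Q: "cok_square R M' N' f' M'' N'' f'' q"
    and comp: "\<And>x. x \<in> carrier N \<Longrightarrow> q (p x) = \<zero>\<^bsub>N''\<^esub>"
  shows "short_complex R (cokernel M N f) (cokernel M' N' f') (cokernel M'' N'' f'')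
    (cok_map M' N' f' p) (cok_map M'' N'' f'' q)"
proof -
  interpret P: cok_square R M N f M' N' f' p by fact
  interpret Q: cok_square R M' N' f' M'' N'' f'' q by fact
  have "cok_map M'' N'' f'' q (cok_map M' N' f' p X) = \<zero>\<^bsub>cokernel M'' N'' f''\<^esub>"
    if "X \<in> carrier (cokernel M N f)" for X
  proof -
    obtain x where x: "x \<in> carrier N" "X = f ` carrier M +>\<^bsub>N\<^esub> x"
      using \<open>X \<in> _\<close> P.f.cokernel_carrier by auto
    have "\<zero>\<^bsub>N''\<^esub> \<in> f'' ` carrier M''"
      using Q.f'.N.submoduleD(2)[OF Q.f'.submodule_range] .
    then show ?thesis
      using Q.cok_map_eq_zero_iff[OF P.p.map_closed[OF x(1)]] comp[OF x(1)]
      unfolding x(2) P.cok_map_coset[OF x(1)] by simp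
  qed
  then show ?thesis
    unfolding short_complex_def
    using P.f.left_module_cokernel P.f'.left_module_cokernel Q.f'.left_module_cokernel
      P.cok_map_lin Q.cok_map_lin by blast
qed

text \<open>This and the next two lemmas view each position of a short complex as the middle of a
  three-term complex, one for each conjunct of \<open>isomorphic_homology\<close>.\<close>

lemma three_term_complex_middle:
  "short_complex R X Y Z u v \<Longrightarrow> three_term_complex R X Y Z u v"
  by (simp add: short_complex_def three_term_complex_def three_term_complex_axioms_def lin_mapI)

lemma three_term_complex_left:
  fixes R :: "('r, 'k) ring_scheme"
  assumes "short_complex R X Y Z u v"
  shows "three_term_complex R (zero_module :: ('r, unit) module) X Y (zero_map X) u"
proof -
  interpret u: lin_map R X Y u using assms by (simp add: short_complex_def lin_mapI)
  interpret z: lin_map R "zero_module :: ('r, unit) module" X "zero_map X"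
    by (intro lin_mapI left_module_zero_module zero_map_lin u.M.left_module_axioms u.M.R.ring_axioms)
  show ?thesis by unfold_locales (simp add: zero_map_def u.map_zero)
qed

lemma three_term_complex_right:
  fixes R :: "('r, 'k) ring_scheme"
  assumes "short_complex R X Y Z u v"
  shows "three_term_complex R Y Z (zero_module :: ('r, unit) module) v (zero_map (zero_module :: ('r, unit) module))"
proof -
  interpret v: lin_map R Y Z v using assms by (simp add: short_complex_def lin_mapI)
  interpret z: lin_map R Z "zero_module :: ('r, unit) module" "zero_map (zero_module :: ('r, unit) module)"
    by (intro lin_mapI left_module_zero_module zero_map_lin v.N.left_module_axioms v.M.R.ring_axioms)
  show ?thesis by unfold_locales (simp add: zero_map_def)
qed

lemma zero_map_range: "zero_map N ` carrier zero_module = {\<zero>\<^bsub>N\<^esub>}"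
  by (auto simp: zero_map_def zero_module_def)

section \<open>The diagram, its symmetry and the chases\<close>

text \<open>Exactness at \<open>C'\<close> and \<open>A''\<close> enters as a trivial kernel.
  Reflection in the diagonal exchanges \<open>sq_A\<close> with \<open>sq_B'\<close> and the row
  conditions at \<open>B\<close>, \<open>C'\<close>, \<open>C\<close> with the column conditions at
  \<open>B\<close>, \<open>A''\<close>, \<open>B''\<close>; \<open>sq_B\<close> goes to
  itself.\<close>

locale corner_diagram =
  \<alpha>: lin_map R A A'' \<alpha> +
  \<beta>': lin_map R B' B \<beta>' + \<beta>: lin_map R B B'' \<beta> +
  \<gamma>': lin_map R C' C \<gamma>' + \<gamma>: lin_map R C C'' \<gamma> +
  g': lin_map R B' C' g' +
  f: lin_map R A B f + g: lin_map R B C g +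
  f'': lin_map R A'' B'' f'' + g'': lin_map R B'' C'' g''
  for R (structure)
    and A (structure) and A'' (structure)
    and B' (structure) and B (structure) and B'' (structure)
    and C' (structure) and C (structure) and C'' (structure)
    and \<alpha> \<beta>' \<beta> \<gamma>' \<gamma> g' f g f'' g'' +
  assumes sq_A: "x \<in> carrier A \<Longrightarrow> \<beta> (f x) = f'' (\<alpha> x)"
    and sq_B': "y \<in> carrier B' \<Longrightarrow> g (\<beta>' y) = \<gamma>' (g' y)"
    and sq_B: "b \<in> carrier B \<Longrightarrow> g'' (\<beta> b) = \<gamma> (g b)"
    and exact_row_B: "\<beta>' ` carrier B' = a_kernel B B'' \<beta>"
    and exact_row_C': "a_kernel C' C \<gamma>' = {\<zero>\<^bsub>C'\<^esub>}"
    and exact_row_C: "\<gamma>' ` carrier C' = a_kernel C C'' \<gamma>"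
    and exact_col_B: "f ` carrier A = a_kernel B C g"
    and exact_col_A'': "a_kernel A'' B'' f'' = {\<zero>\<^bsub>A''\<^esub>}"
    and exact_col_B'': "f'' ` carrier A'' = a_kernel B'' C'' g''"
begin

text \<open>The reflection fixes \<open>B\<close> and \<open>C''\<close> and exchanges
  \<open>A\<close> with \<open>B'\<close>, \<open>A''\<close> with \<open>C'\<close> and
  \<open>B''\<close> with \<open>C\<close>. Horizontal and vertical maps change places, so each
  result on rows yields one on columns.\<close>

lemma transposed: "corner_diagram R B' C' A B C A'' B'' C'' g' f g f'' g'' \<alpha> \<beta>' \<beta> \<gamma>' \<gamma>"
  by unfold_locales
     (simp_all add: sq_A sq_B' sq_B exact_row_B exact_row_C' exact_row_C exact_col_B exact_col_A'' exact_col_B'')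

lemma \<gamma>'_inj:
  assumes "x \<in> carrier C'" "y \<in> carrier C'" "\<gamma>' x = \<gamma>' y"
  shows "x = y"
proof -
  have "\<gamma>' (x \<ominus>\<^bsub>C'\<^esub> y) = \<zero>\<^bsub>C\<^esub>"
    unfolding \<gamma>'.map_diff[OF assms(1,2)] using assms \<gamma>'.map_closed
    by (simp add: \<gamma>'.N.minus_eq_iff)
  then have "x \<ominus>\<^bsub>C'\<^esub> y \<in> a_kernel C' C \<gamma>'"
    using assms by (simp add: mem_a_kernel)
  then show ?thesis using exact_row_C' assms by (simp add: \<gamma>'.M.minus_eq_iff)
qed

lemma gf_zero: "x \<in> carrier A \<Longrightarrow> g (f x) = \<zero>\<^bsub>C\<^esub>"
  using exact_col_B unfolding set_eq_iff mem_a_kernel by blast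

lemma g''f''_zero: "x \<in> carrier A'' \<Longrightarrow> g'' (f'' x) = \<zero>\<^bsub>C''\<^esub>"
  using exact_col_B'' unfolding set_eq_iff mem_a_kernel by blast

text \<open>Since \<open>\<gamma> (g b) = g'' (\<beta> b) = g'' (f'' a) = 0\<close>, exactness at
  \<open>C\<close> lifts \<open>g b\<close> along \<open>\<gamma>'\<close>.\<close>

lemma lift_to_C':
  assumes "a \<in> carrier A''" "b \<in> carrier B" "\<beta> b = f'' a"
  shows "\<exists>c\<in>carrier C'. g b = \<gamma>' c"
proof -
  have "\<gamma> (g b) = \<zero>\<^bsub>C''\<^esub>"
    using sq_B[OF assms(2)] g''f''_zero[OF assms(1)] assms(3) by simp
  then have "g b \<in> a_kernel C C'' \<gamma>"
    using g.map_closed[OF assms(2)] by (simp add: mem_a_kernel)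
  then show ?thesis unfolding exact_row_C[symmetric] by blast
qed

text \<open>If a = \<open>\<alpha> x\<close>, then \<open>\<beta>\<close> kills b -
  \<open>f x\<close>, so exactness at \<open>B\<close> writes this difference as
  \<open>\<beta>' y\<close>. Applying g, where \<open>g (f x)\<close> vanishes, gives
  \<open>\<gamma>' (g' y) = \<gamma>' c\<close>, and c = \<open>g' y\<close> because
  \<open>\<gamma>'\<close> is injective.\<close>

lemma left_boundary:
  assumes "a \<in> \<alpha> ` carrier A" "b \<in> carrier B" "c \<in> carrier C'" "\<beta> b = f'' a" "g b = \<gamma>' c"
  shows "c \<in> g' ` carrier B'"
proof -
  obtain x where x: "x \<in> carrier A" "a = \<alpha> x" using assms(1) by blast
  have fx: "f x \<in> carrier B" using f.map_closed x(1) .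
  have "\<beta> (b \<ominus>\<^bsub>B\<^esub> f x) = \<zero>\<^bsub>B''\<^esub>"
    unfolding \<beta>.map_diff[OF assms(2) fx] assms(4) x(2) sq_A[OF x(1)]
    using x(1) f''.map_closed \<alpha>.map_closed by (simp add: \<beta>.N.minus_eq_iff)
  then have "b \<ominus>\<^bsub>B\<^esub> f x \<in> \<beta>' ` carrier B'"
    unfolding exact_row_B mem_a_kernel using assms(2) fx by simp
  then obtain y where y: "y \<in> carrier B'" "b \<ominus>\<^bsub>B\<^esub> f x = \<beta>' y" by blast
  have "\<gamma>' (g' y) = g (b \<ominus>\<^bsub>B\<^esub> f x)" using sq_B'[OF y(1)] y(2) by simp
  also have "\<dots> = \<gamma>' c"
    unfolding g.map_diff[OF assms(2) fx] gf_zero[OF x(1)] assms(5)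
    using \<gamma>'.map_closed[OF assms(3)] by (simp add: \<gamma>'.N.minus_eq_iff)
  finally have "g' y = c" using \<gamma>'_inj g'.map_closed[OF y(1)] assms(3) by blast
  then show ?thesis using y(1) by blast
qed

text \<open>For b = \<open>\<beta> m\<close> + \<open>f'' x\<close> the second summand dies under
  \<open>g''\<close>, so \<open>\<gamma> c = g'' (\<beta> m) = \<gamma> (g m)\<close>. Exactness at
  \<open>C\<close> then puts c - \<open>g m\<close> into the image of
  \<open>\<gamma>'\<close>.\<close>

lemma middle_boundary:
  assumes "c \<in> carrier C" "g'' b = \<gamma> c"
    and ex: "\<exists>x\<in>carrier A''. \<exists>m\<in>carrier B. b = \<beta> m \<oplus>\<^bsub>B''\<^esub> f'' x"
  shows "\<exists>x\<in>carrier C'. \<exists>m\<in>carrier B. c = g m \<oplus>\<^bsub>C\<^esub> \<gamma>' x"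
proof -
  obtain x m where x: "x \<in> carrier A''" and m: "m \<in> carrier B" and b: "b = \<beta> m \<oplus>\<^bsub>B''\<^esub> f'' x"
    using ex by blast
  have gm: "g m \<in> carrier C" using g.map_closed m .
  have "\<gamma> c = \<gamma> (g m)"
    unfolding assms(2)[symmetric] b g''.map_add[OF \<beta>.map_closed[OF m] f''.map_closed[OF x]]
      g''f''_zero[OF x] sq_B[OF m]
    using \<gamma>.map_closed[OF gm] by simp
  then have "\<gamma> (c \<ominus>\<^bsub>C\<^esub> g m) = \<zero>\<^bsub>C''\<^esub>"
    unfolding \<gamma>.map_diff[OF assms(1) gm] using \<gamma>.map_closed[OF gm] by (simp add: \<gamma>.N.minus_eq_iff)
  then have "c \<ominus>\<^bsub>C\<^esub> g m \<in> \<gamma>' ` carrier C'"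
    unfolding exact_row_C mem_a_kernel using assms(1) gm by simp
  then obtain y where y: "y \<in> carrier C'" "c \<ominus>\<^bsub>C\<^esub> g m = \<gamma>' y" by blast
  then have "c = \<gamma>' y \<oplus>\<^bsub>C\<^esub> g m"
    using \<gamma>'.N.minus_eq_iff[OF assms(1) gm] \<gamma>'.map_closed by blast
  \<comment> \<open>The summands are swapped into the order in which the transposed
    \<open>coset_in_cok_map_range_iff\<close> presents them.\<close>
  then have "c = g m \<oplus>\<^bsub>C\<^esub> \<gamma>' y"
    using \<gamma>'.N.a_comm gm \<gamma>'.map_closed[OF y(1)] by simp
  then show ?thesis using y(1) m by blast
qed

text \<open>The squares inducing the two maps between the cokernels of \<open>\<alpha>\<close>,
  \<open>\<beta>\<close> and \<open>\<gamma>\<close>.\<close>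

sublocale f'': cok_square R A A'' \<alpha> B B'' \<beta> f''
  by unfold_locales (simp flip: sq_A add: f.map_closed)

sublocale g'': cok_square R B B'' \<beta> C C'' \<gamma> g''
  by unfold_locales (simp add: sq_B g.map_closed)

lemma short_complex_row:
  "short_complex R (cokernel A A'' \<alpha>) (cokernel B B'' \<beta>) (cokernel C C'' \<gamma>)
    (cok_map B B'' \<beta> f'') (cok_map C C'' \<gamma> g'')"
  by (rule short_complex_cok_map[OF f''.cok_square_axioms g''.cok_square_axioms g''f''_zero])

text \<open>Supplies the other complex: \<open>t.f''\<close> and \<open>t.g''\<close> are the
  squares inducing the maps from \<open>\<gamma>'\<close> and \<open>\<gamma>\<close> between the
  cokernels of \<open>g'\<close>, \<open>g\<close> and \<open>g''\<close>.\<close>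

interpretation t: corner_diagram R B' C' A B C A'' B'' C'' g' f g f'' g'' \<alpha> \<beta>' \<beta> \<gamma>' \<gamma>
  by (rule transposed)

section \<open>The three isomorphisms of homology\<close>

text \<open>The incoming maps are zero, so a cycle is a boundary exactly when its representative
  lies in the image of \<open>\<alpha>\<close>, respectively \<open>g'\<close>. The element of
  \<open>B\<close> that links a and c arises by lifting \<open>f'' a\<close> along
  \<open>\<beta>\<close> or \<open>\<gamma>' c\<close> along \<open>g\<close>.\<close>

lemma isomorphic_homology_left:
  "mod_isomorphic R
    (homology zero_module (cokernel A A'' \<alpha>) (cokernel B B'' \<beta>)
      (zero_map (cokernel A A'' \<alpha>)) (cok_map B B'' \<beta> f''))
    (homology zero_module (cokernel B' C' g') (cokernel B C g)
      (zero_map (cokernel B' C' g')) (cok_map B C g \<gamma>'))"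
proof -
  define T where "T = {(a, c). a \<in> carrier A'' \<and> c \<in> carrier C' \<and> (\<exists>b\<in>carrier B. \<beta> b = f'' a \<and> g b = \<gamma>' c)}"
  show ?thesis
  proof (rule homology_isomorphic_by_relation[where T = T])
    show "homology_at_cokernel R A A'' \<alpha> zero_module (cokernel B B'' \<beta>) (zero_map (cokernel A A'' \<alpha>)) (cok_map B B'' \<beta> f'')"
      by (rule homology_at_cokernel.intro[OF \<alpha>.lin_map_axioms three_term_complex_left[OF short_complex_row]])
    show "homology_at_cokernel R B' C' g' zero_module (cokernel B C g) (zero_map (cokernel B' C' g')) (cok_map B C g \<gamma>')"
      by (rule homology_at_cokernel.intro[OF g'.lin_map_axioms three_term_complex_left[OF t.short_complex_row]])
    show "T \<subseteq> carrier A'' \<times> carrier C'" unfolding T_def by blast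
  next
    fix a assume a: "a \<in> carrier A''"
    show "cok_map B B'' \<beta> f'' (\<alpha> ` carrier A +>\<^bsub>A''\<^esub> a) = \<zero>\<^bsub>cokernel B B'' \<beta>\<^esub> \<longleftrightarrow> (\<exists>c. (a, c) \<in> T)"
      unfolding f''.cok_map_eq_zero_iff[OF a]
    proof
      assume "f'' a \<in> \<beta> ` carrier B"
      then obtain b where b: "b \<in> carrier B" "\<beta> b = f'' a" by auto
      then obtain c where "c \<in> carrier C'" "g b = \<gamma>' c" using lift_to_C'[OF a] by blast
      then show "\<exists>c. (a, c) \<in> T" using a b unfolding T_def by blast
    next
      assume "\<exists>c. (a, c) \<in> T"
      then show "f'' a \<in> \<beta> ` carrier B" unfolding T_def by (blast intro: image_eqI[OF sym])
    qed
  next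
    fix c assume c: "c \<in> carrier C'"
    show "cok_map B C g \<gamma>' (g' ` carrier B' +>\<^bsub>C'\<^esub> c) = \<zero>\<^bsub>cokernel B C g\<^esub> \<longleftrightarrow> (\<exists>a. (a, c) \<in> T)"
      unfolding t.f''.cok_map_eq_zero_iff[OF c]
    proof
      assume "\<gamma>' c \<in> g ` carrier B"
      then obtain b where b: "b \<in> carrier B" "g b = \<gamma>' c" by auto
      \<comment> \<open>In transposed form the lifting lemma uses exactness at \<open>B''\<close> to
        write \<open>\<beta> b\<close> as \<open>f'' a\<close>.\<close>
      then obtain a where "a \<in> carrier A''" "\<beta> b = f'' a" using t.lift_to_C'[OF c] by blast
      then show "\<exists>a. (a, c) \<in> T" using c b unfolding T_def by blast
    next
      assume "\<exists>a. (a, c) \<in> T"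
      then show "\<gamma>' c \<in> g ` carrier B" unfolding T_def by (blast intro: image_eqI[OF sym])
    qed
  next
    fix a c a' c' assume "(a, c) \<in> T" "(a', c') \<in> T"
    then obtain b b' where h: "b \<in> carrier B" "b' \<in> carrier B" "\<beta> b = f'' a" "g b = \<gamma>' c" "\<beta> b' = f'' a'" "g b' = \<gamma>' c'"
      "a \<in> carrier A''" "a' \<in> carrier A''" "c \<in> carrier C'" "c' \<in> carrier C'"
      unfolding T_def by blast
    then have "\<beta> (b \<oplus>\<^bsub>B\<^esub> b') = f'' (a \<oplus>\<^bsub>A''\<^esub> a')" "g (b \<oplus>\<^bsub>B\<^esub> b') = \<gamma>' (c \<oplus>\<^bsub>C'\<^esub> c')"
      by (simp_all add: \<beta>.map_add g.map_add f''.map_add \<gamma>'.map_add)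
    then show "(a \<oplus>\<^bsub>A''\<^esub> a', c \<oplus>\<^bsub>C'\<^esub> c') \<in> T"
      \<comment> \<open>The sum of the two linking elements of \<open>B\<close> links the
        sums.\<close>
      using h(1,2,7-) unfolding T_def by (auto intro!: bexI[of _ "b \<oplus>\<^bsub>B\<^esub> b'"])
  next
    fix r a c assume r: "r \<in> carrier R" and "(a, c) \<in> T"
    then obtain b where h: "b \<in> carrier B" "\<beta> b = f'' a" "g b = \<gamma>' c" "a \<in> carrier A''" "c \<in> carrier C'"
      unfolding T_def by blast
    then have "\<beta> (r \<odot>\<^bsub>B\<^esub> b) = f'' (r \<odot>\<^bsub>A''\<^esub> a)" "g (r \<odot>\<^bsub>B\<^esub> b) = \<gamma>' (r \<odot>\<^bsub>C'\<^esub> c)"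
      using r by (simp_all add: \<beta>.map_smult g.map_smult f''.map_smult \<gamma>'.map_smult)
    then show "(r \<odot>\<^bsub>A''\<^esub> a, r \<odot>\<^bsub>C'\<^esub> c) \<in> T"
      using h(1,4,5) r \<beta>'.N.smult_closed \<alpha>.N.smult_closed \<gamma>'.M.smult_closed
      unfolding T_def by (auto intro!: bexI[of _ "r \<odot>\<^bsub>B\<^esub> b"])
  next
    fix a c assume "(a, c) \<in> T"
    then obtain b where h: "b \<in> carrier B" "\<beta> b = f'' a" "g b = \<gamma>' c" "a \<in> carrier A''" "c \<in> carrier C'"
      unfolding T_def by blast
    \<comment> \<open>One implication is the chase \<open>left_boundary\<close>, the other its
      transpose with the same linking element.\<close>
    have "a \<in> \<alpha> ` carrier A \<longleftrightarrow> c \<in> g' ` carrier B'"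
      using left_boundary[OF _ h(1,5,2,3)] t.left_boundary[OF _ h(1,4,3,2)] by blast
    then show "\<alpha> ` carrier A +>\<^bsub>A''\<^esub> a \<in> zero_map (cokernel A A'' \<alpha>) ` carrier zero_module \<longleftrightarrow>
        g' ` carrier B' +>\<^bsub>C'\<^esub> c \<in> zero_map (cokernel B' C' g') ` carrier zero_module"
      unfolding zero_map_range \<alpha>.cokernel_zero g'.cokernel_zero singleton_iff
        \<alpha>.N.coset_eq_self_iff[OF \<alpha>.submodule_range h(4)] \<gamma>'.M.coset_eq_self_iff[OF g'.submodule_range h(5)] .
  qed
qed

text \<open>An element b represents a cycle exactly when \<open>g'' b\<close> lies in the image of
  \<open>\<gamma>\<close>, which says that some c is related to it; the same holds for c with the
  roles exchanged. Boundaries correspond by \<open>middle_boundary\<close> and its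
  transpose.\<close>

lemma isomorphic_homology_middle:
  "mod_isomorphic R
    (homology (cokernel A A'' \<alpha>) (cokernel B B'' \<beta>) (cokernel C C'' \<gamma>)
      (cok_map B B'' \<beta> f'') (cok_map C C'' \<gamma> g''))
    (homology (cokernel B' C' g') (cokernel B C g) (cokernel B'' C'' g'')
      (cok_map B C g \<gamma>') (cok_map B'' C'' g'' \<gamma>))"
proof -
  define T where "T = {(b, c). b \<in> carrier B'' \<and> c \<in> carrier C \<and> g'' b = \<gamma> c}"
  show ?thesis
  proof (rule homology_isomorphic_by_relation[where T = T])
    show "homology_at_cokernel R B B'' \<beta> (cokernel A A'' \<alpha>) (cokernel C C'' \<gamma>) (cok_map B B'' \<beta> f'') (cok_map C C'' \<gamma> g'')"
      by (rule homology_at_cokernel.intro[OF \<beta>.lin_map_axioms three_term_complex_middle[OF short_complex_row]])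
    show "homology_at_cokernel R B C g (cokernel B' C' g') (cokernel B'' C'' g'') (cok_map B C g \<gamma>') (cok_map B'' C'' g'' \<gamma>)"
      by (rule homology_at_cokernel.intro[OF g.lin_map_axioms three_term_complex_middle[OF t.short_complex_row]])
    show "T \<subseteq> carrier B'' \<times> carrier C" unfolding T_def by blast
  next
    fix b assume b: "b \<in> carrier B''"
    show "cok_map C C'' \<gamma> g'' (\<beta> ` carrier B +>\<^bsub>B''\<^esub> b) = \<zero>\<^bsub>cokernel C C'' \<gamma>\<^esub> \<longleftrightarrow> (\<exists>c. (b, c) \<in> T)"
      unfolding g''.cok_map_eq_zero_iff[OF b] T_def using b by auto
  next
    fix c assume c: "c \<in> carrier C"
    show "cok_map B'' C'' g'' \<gamma> (g ` carrier B +>\<^bsub>C\<^esub> c) = \<zero>\<^bsub>cokernel B'' C'' g''\<^esub> \<longleftrightarrow> (\<exists>b. (b, c) \<in> T)"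
      unfolding t.g''.cok_map_eq_zero_iff[OF c] T_def using c by (auto simp: image_iff eq_commute)
  next
    fix b c b' c' assume "(b, c) \<in> T" "(b', c') \<in> T"
    then show "(b \<oplus>\<^bsub>B''\<^esub> b', c \<oplus>\<^bsub>C\<^esub> c') \<in> T"
      unfolding T_def by (simp add: \<gamma>.map_add g''.map_add)
  next
    fix r b c assume "r \<in> carrier R" "(b, c) \<in> T"
    then show "(r \<odot>\<^bsub>B''\<^esub> b, r \<odot>\<^bsub>C\<^esub> c) \<in> T"
      unfolding T_def by (simp add: \<gamma>.map_smult g''.map_smult \<beta>.N.smult_closed \<gamma>'.N.smult_closed)
  next
    fix b c assume "(b, c) \<in> T"
    then have h: "b \<in> carrier B''" "c \<in> carrier C" "g'' b = \<gamma> c"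
      unfolding T_def by blast+
    show "\<beta> ` carrier B +>\<^bsub>B''\<^esub> b \<in> cok_map B B'' \<beta> f'' ` carrier (cokernel A A'' \<alpha>) \<longleftrightarrow>
        g ` carrier B +>\<^bsub>C\<^esub> c \<in> cok_map B C g \<gamma>' ` carrier (cokernel B' C' g')"
      unfolding f''.coset_in_cok_map_range_iff[OF h(1)] t.f''.coset_in_cok_map_range_iff[OF h(2)]
      by (rule iffI, erule middle_boundary[OF h(2,3)], erule t.middle_boundary[OF h(1) h(3)[symmetric]])
  qed
qed

text \<open>The outgoing maps are zero, so on both sides every element of \<open>C''\<close>
  represents a cycle, and the boundaries are represented by the sums of an element of the image of
  \<open>\<gamma>\<close> and one of the image of \<open>g''\<close>.\<close>

lemma isomorphic_homology_right:
  "mod_isomorphic R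
    (homology (cokernel B B'' \<beta>) (cokernel C C'' \<gamma>) zero_module
      (cok_map C C'' \<gamma> g'') (zero_map (zero_module :: ('a, unit) module)))
    (homology (cokernel B C g) (cokernel B'' C'' g'') zero_module
      (cok_map B'' C'' g'' \<gamma>) (zero_map (zero_module :: ('a, unit) module)))"
proof (rule homology_isomorphic_by_relation[where T = "Id_on (carrier C'')"])
  show "homology_at_cokernel R C C'' \<gamma> (cokernel B B'' \<beta>) zero_module (cok_map C C'' \<gamma> g'') (zero_map (zero_module :: ('a, unit) module))"
    by (rule homology_at_cokernel.intro[OF \<gamma>.lin_map_axioms three_term_complex_right[OF short_complex_row]])
  show "homology_at_cokernel R B'' C'' g'' (cokernel B C g) zero_module (cok_map B'' C'' g'' \<gamma>) (zero_map (zero_module :: ('a, unit) module))"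
    by (rule homology_at_cokernel.intro[OF g''.lin_map_axioms three_term_complex_right[OF t.short_complex_row]])
next
  fix x y assume "(x, y) \<in> Id_on (carrier C'')"
  then have x: "x \<in> carrier C''" and xy: "y = x" by auto
  \<comment> \<open>The two descriptions of boundaries differ only in the order of the
    summands.\<close>
  have "x = \<gamma> m \<oplus>\<^bsub>C''\<^esub> g'' b \<longleftrightarrow> x = g'' b \<oplus>\<^bsub>C''\<^esub> \<gamma> m" if "m \<in> carrier C" "b \<in> carrier B''" for m b
    using \<gamma>.N.a_comm \<gamma>.map_closed[OF that(1)] g''.map_closed[OF that(2)] by simp
  then show "\<gamma> ` carrier C +>\<^bsub>C''\<^esub> x \<in> cok_map C C'' \<gamma> g'' ` carrier (cokernel B B'' \<beta>) \<longleftrightarrow>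
      g'' ` carrier B'' +>\<^bsub>C''\<^esub> y \<in> cok_map B'' C'' g'' \<gamma> ` carrier (cokernel B C g)"
    unfolding xy g''.coset_in_cok_map_range_iff[OF x] t.g''.coset_in_cok_map_range_iff[OF x] by blast
qed (auto simp: zero_map_def \<gamma>.N.smult_closed)

lemma isomorphic_homology_cokernels:
  "short_complex R (cokernel A A'' \<alpha>) (cokernel B B'' \<beta>) (cokernel C C'' \<gamma>)
     (cok_map B B'' \<beta> f'') (cok_map C C'' \<gamma> g'')
   \<and> short_complex R (cokernel B' C' g') (cokernel B C g) (cokernel B'' C'' g'')
     (cok_map B C g \<gamma>') (cok_map B'' C'' g'' \<gamma>)
   \<and> isomorphic_homology R
     (cokernel A A'' \<alpha>) (cokernel B B'' \<beta>) (cokernel C C'' \<gamma>)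
     (cok_map B B'' \<beta> f'') (cok_map C C'' \<gamma> g'')
     (cokernel B' C' g') (cokernel B C g) (cokernel B'' C'' g'')
     (cok_map B C g \<gamma>') (cok_map B'' C'' g'' \<gamma>)"
  unfolding isomorphic_homology_def
  by (intro conjI short_complex_row t.short_complex_row isomorphic_homology_left
      isomorphic_homology_middle isomorphic_homology_right)

end

theorem proposition1p4:
  fixes R :: "('r, 'k) ring_scheme"
    and A :: "('r, 'a) module" and A'' :: "('r, 'a2) module"
    and B' :: "('r, 'b1) module" and B :: "('r, 'b) module" and B'' :: "('r, 'b2) module"
    and C' :: "('r, 'c1) module" and C :: "('r, 'c) module" and C'' :: "('r, 'c2) module"
    and \<alpha> :: "'a \<Rightarrow> 'a2"
    and \<beta>' :: "'b1 \<Rightarrow> 'b" and \<beta> :: "'b \<Rightarrow> 'b2"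
    and \<gamma>' :: "'c1 \<Rightarrow> 'c" and \<gamma> :: "'c \<Rightarrow> 'c2"
    and g' :: "'b1 \<Rightarrow> 'c1"
    and f :: "'a \<Rightarrow> 'b" and g :: "'b \<Rightarrow> 'c"
    and f'' :: "'a2 \<Rightarrow> 'b2" and g'' :: "'b2 \<Rightarrow> 'c2"
  assumes "ring R"
    and "left_module R A" and "left_module R A''"
    and "left_module R B'" and "left_module R B" and "left_module R B''"
    and "left_module R C'" and "left_module R C" and "left_module R C''"
    and "\<alpha> \<in> lin_maps R A A''"
    and "\<beta>' \<in> lin_maps R B' B" and "\<beta> \<in> lin_maps R B B''"
    and "\<gamma>' \<in> lin_maps R C' C" and "\<gamma> \<in> lin_maps R C C''"
    and "g' \<in> lin_maps R B' C'"
    and "f \<in> lin_maps R A B" and "g \<in> lin_maps R B C"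
    and "f'' \<in> lin_maps R A'' B''" and "g'' \<in> lin_maps R B'' C''"
    and "\<And>x. x \<in> carrier A \<Longrightarrow> \<beta> (f x) = f'' (\<alpha> x)"
    and "\<And>x. x \<in> carrier B' \<Longrightarrow> g (\<beta>' x) = \<gamma>' (g' x)"
    and "\<And>x. x \<in> carrier B \<Longrightarrow> g'' (\<beta> x) = \<gamma> (g x)"
    and "exact_at B' B B'' \<beta>' \<beta>"
    and "exact_at (zero_module :: ('r, unit) module) C' C (zero_map C') \<gamma>'"
    and "exact_at C' C C'' \<gamma>' \<gamma>"
    and "exact_at A B C f g"
    and "exact_at (zero_module :: ('r, unit) module) A'' B'' (zero_map A'') f''"
    and "exact_at A'' B'' C'' f'' g''"
  shows "short_complex R (cokernel A A'' \<alpha>) (cokernel B B'' \<beta>) (cokernel C C'' \<gamma>)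
           (cok_map B B'' \<beta> f'') (cok_map C C'' \<gamma> g'')
       \<and> short_complex R (cokernel B' C' g') (cokernel B C g) (cokernel B'' C'' g'')
           (cok_map B C g \<gamma>') (cok_map B'' C'' g'' \<gamma>)
       \<and> isomorphic_homology R
           (cokernel A A'' \<alpha>) (cokernel B B'' \<beta>) (cokernel C C'' \<gamma>)
           (cok_map B B'' \<beta> f'') (cok_map C C'' \<gamma> g'')
           (cokernel B' C' g') (cokernel B C g) (cokernel B'' C'' g'')
           (cok_map B C g \<gamma>') (cok_map B'' C'' g'' \<gamma>)"
proof -
  \<comment> \<open>These are the exactness conditions at \<open>C'\<close> and \<open>A''\<close>:
    the image of the zero map is the zero submodule, so both kernels are trivial.\<close>
  have inj: "a_kernel C' C \<gamma>' = {\<zero>\<^bsub>C'\<^esub>}" "a_kernel A'' B'' f'' = {\<zero>\<^bsub>A''\<^esub>}"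
    using assms(24,27) unfolding exact_at_def zero_map_range by auto
  have "corner_diagram R A A'' B' B B'' C' C C'' \<alpha> \<beta>' \<beta> \<gamma>' \<gamma> g' f g f'' g''"
    using assms inj unfolding exact_at_def
    by (intro corner_diagram.intro corner_diagram_axioms.intro lin_mapI) simp_all
  then show ?thesis by (rule corner_diagram.isomorphic_homology_cokernels)
qed

end
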